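(* Suppose that $X$ is a Banach space. Let $m\in\mathbb{N}$, and for each $i\in\{1,2,\ldots,m\}$ let $\varepsilon_i\geq0$ and let $f_i:X\to\left]-\infty,+\infty\right]$ be proper, lower semicontinuous and convex. Assume that $$\operatorname{dom} f_1\cap\Big(\bigcap_{i=2}^{m}\operatorname{int}\operatorname{dom} f_i\Big)\neq\varnothing.$$ Then for every $x\in \bigcap_{i=1}^{m}\operatorname{dom} f_i$, the set $\sum_{i=1}^{m}\partial_{\varepsilon_i} f_i(x)$ is weak$^*$ closed.
   Context: $X^*$ is the continuous dual of $X$, endowed with the weak$^*$ topology $\omega(X^*,X)$. Sums of sets are Minkowski sums; $\operatorname{int}$ denotes interior. For $f:X\to\left]-\infty,+\infty\right]$: $\operatorname{dom} f=\{x: f(x)<+\infty\}$; $f$ is proper if $\operatorname{dom} f\neq\varnothing$. For $\varepsilon\ge0$, $\partial_\varepsilon f(x)=\{x^*\in X^*: \langle y-x,x^*\rangle+f(x)\le f(y)+\varepsilon\ \ \forall y\in X\}$ if $f(x)\in\mathbb{R}$, and $\partial_\varepsilon f(x)=\varnothing$ otherwise. *)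

theory Defs
  imports "HOL-Analysis.Analysis"
begin

text \<open>Functions into the half-open interval from \<open>-\<infinity>\<close> (excluded) to \<open>+\<infinity>\<close> are rendered as
  functions into \<^typ>\<open>ereal\<close> together with a separate hypothesis that \<open>-\<infinity>\<close> is never attained.\<close>

definition edom :: "('a \<Rightarrow> ereal) \<Rightarrow> 'a set" where
  "edom f = {x. f x < \<infinity>}"

definition proper_fun :: "('a \<Rightarrow> ereal) \<Rightarrow> bool" where
  "proper_fun f \<longleftrightarrow> edom f \<noteq> {}"

definition lower_semicontinuous :: "('a::topological_space \<Rightarrow> ereal) \<Rightarrow> bool" where
  "lower_semicontinuous f \<longleftrightarrow> (\<forall>x. \<forall>a<f x. \<forall>\<^sub>F y in nhds x. a < f y)"

text \<open>Only meant for functions that avoid \<open>-\<infinity>\<close>, so that the sum on the right-hand side is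
  never of the form \<open>\<infinity> - \<infinity>\<close>.\<close>

definition econvex :: "('a::real_vector \<Rightarrow> ereal) \<Rightarrow> bool" where
  "econvex f \<longleftrightarrow> (\<forall>x y. \<forall>t. 0 < t \<and> t < 1 \<longrightarrow>
     f ((1 - t) *\<^sub>R x + t *\<^sub>R y) \<le> ereal (1 - t) * f x + ereal t * f y)"

text \<open>The continuous dual of \<^typ>\<open>'a\<close> is the type \<^typ>\<open>'a \<Rightarrow>\<^sub>L real\<close>.\<close>

definition eps_subdifferential ::
    "real \<Rightarrow> ('a::real_normed_vector \<Rightarrow> ereal) \<Rightarrow> 'a \<Rightarrow> ('a \<Rightarrow>\<^sub>L real) set" where
  "eps_subdifferential \<epsilon> f x =
     (if \<bar>f x\<bar> \<noteq> \<infinity>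
      then {x'. \<forall>y. ereal (blinfun_apply x' (y - x)) + f x \<le> f y + ereal \<epsilon>}
      else {})"

text \<open>For scalar-valued operators the strong operator topology, i.e. the topology of pointwise
  convergence pulled back along \<^const>\<open>blinfun_apply\<close>, is the weak* topology.\<close>

abbreviation weak_star_topology :: "('a::real_normed_vector \<Rightarrow>\<^sub>L real) topology" where
  "weak_star_topology \<equiv> strong_operator_topology"

end

theory Submission
  imports Defs
begin

text \<open>Let \<open>z\<close> lie in the domain of \<open>f 1\<close> and in the interior of the other domains, and let
  \<open>u\<close> be in the weak* closure of the sum. Near \<open>u\<close> the value at \<open>z - x\<close> of a sum
  \<open>\<Sum>i. a i\<close> of \<open>\<epsilon> i\<close>-subgradients is bounded below, whereas each \<open>a i (z - x)\<close> is bounded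
  above by the subgradient inequality at \<open>z\<close>; hence each \<open>a i (z - x)\<close> is also bounded below. For
  \<open>i \<ge> 2\<close> the subgradient inequality at \<open>z + t h\<close> then bounds \<open>a i h\<close> for every direction \<open>h\<close>,
  so by uniform boundedness these \<open>a i\<close> stay in a fixed ball, which is weak* compact by
  Banach--Alaoglu. So near \<open>u\<close> the sum is contained in a sum of one closed set and finitely many
  compact sets, which is closed.\<close>

section \<open>Uniform boundedness\<close>

text \<open>A Baire category argument: some closed set \<open>F n\<close> contains a ball, and every
  direction is, up to scaling, a difference of two points of that ball.\<close>

lemma uniform_bounded_blinfun:
  fixes A :: "('a::banach \<Rightarrow>\<^sub>L 'b::real_normed_vector) set"
  assumes "\<And>h. \<exists>C. \<forall>a\<in>A. norm (blinfun_apply a h) \<le> C"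
  shows "\<exists>R. \<forall>a\<in>A. norm a \<le> R"
proof -
  define F where "F n = {h. \<forall>a\<in>A. norm (blinfun_apply a h) \<le> real n}" for n
  have "F n = (\<Inter>a\<in>A. {h. norm (blinfun_apply a h) \<le> real n})" for n
    by (auto simp: F_def)
  then have closed_F: "closed (F n)" for n
    by (auto intro!: closed_INT closed_Collect_le continuous_intros)
  have "h \<in> (\<Union>n. F n)" for h
  proof -
    obtain C where "\<forall>a\<in>A. norm (blinfun_apply a h) \<le> C"
      using assms by blast
    moreover obtain n where "C \<le> real n"
      using real_arch_simple by blast
    ultimately show ?thesis
      by (auto simp: F_def intro: order_trans)
  qed
  then have "(\<Union>n. F n) = UNIV"
    by blast
  then have "\<exists>n. interior (F n) \<noteq> {}"
    using Baire_category_alt[of "euclidean :: 'a topology" "range F"] closed_F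
    by (force simp: completely_metrizable_space_euclidean)
  then obtain n w r where "r > 0" and ball: "cball w r \<subseteq> F n"
    by (auto simp: mem_interior_cball)
  have "norm a \<le> 2 * real n / r" if a: "a \<in> A" for a
  proof (rule norm_blinfun_bound)
    fix h
    show "norm (blinfun_apply a h) \<le> 2 * real n / r * norm h"
    proof (cases "h = 0")
      case False
      \<comment> \<open>\<open>k\<close> points along \<open>h\<close> and has norm
        \<open>r\<close>, so the value of \<open>a\<close> at \<open>k\<close> is a difference of
        two values on the ball; hence the factor 2.\<close>
      define k where "k = (r / norm h) *\<^sub>R h"
      have "w \<in> cball w r" "w + k \<in> cball w r"
        using \<open>r > 0\<close> False by (auto simp: k_def dist_norm)
      then have "w \<in> F n" "w + k \<in> F n"
        using ball by blast+
      then have "norm (blinfun_apply a w) \<le> real n" "norm (blinfun_apply a (w + k)) \<le> real n"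
        using a by (auto simp: F_def)
      then have "norm (blinfun_apply a (w + k) - blinfun_apply a w) \<le> 2 * real n"
        using norm_triangle_ineq4[of "blinfun_apply a (w + k)" "blinfun_apply a w"] by linarith
      then have "(r / norm h) * norm (blinfun_apply a h) \<le> 2 * real n"
        using \<open>r > 0\<close> by (simp add: k_def blinfun.bilinear_simps)
      then show ?thesis
        using \<open>r > 0\<close> False by (simp add: field_simps)
    qed (simp add: blinfun.bilinear_simps)
  qed (use \<open>r > 0\<close> in auto)
  then show ?thesis
    by blast
qed

section \<open>Closed sets, compact sets and Minkowski sums in the weak* topology\<close>

text \<open>Serves twice: subdifferentials are intersections of such half-spaces, and a complement
  of one is the neighbourhood used to localise near a closure point.\<close>

lemma closedin_weak_star_halfspace:
  "closedin weak_star_topology {a. blinfun_apply a h \<le> c}"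
proof -
  have "closedin weak_star_topology
      {a \<in> topspace weak_star_topology. blinfun_apply a h \<in> {..c}}"
    by (rule closedin_continuous_map_preimage[OF strong_operator_topology_continuous_evaluation])
      auto
  then show ?thesis
    by (simp add: strong_operator_topology_topspace)
qed

lemma continuous_map_weak_star_add:
  "continuous_map (prod_topology weak_star_topology weak_star_topology) weak_star_topology
    (\<lambda>p. fst p + snd p)"
  unfolding continuous_on_strong_operator_topo_iff_coordinatewise
  using continuous_map_compose[OF continuous_map_fst strong_operator_topology_continuous_evaluation]
    continuous_map_compose[OF continuous_map_snd strong_operator_topology_continuous_evaluation]
  by (auto simp: blinfun.bilinear_simps o_def intro!: continuous_map_add)

lemma continuous_map_weak_star_diff:
  "continuous_map (prod_topology weak_star_topology weak_star_topology) weak_star_topology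
    (\<lambda>p. fst p - snd p)"
  unfolding continuous_on_strong_operator_topo_iff_coordinatewise
  using continuous_map_compose[OF continuous_map_fst strong_operator_topology_continuous_evaluation]
    continuous_map_compose[OF continuous_map_snd strong_operator_topology_continuous_evaluation]
  by (auto simp: blinfun.bilinear_simps o_def intro!: continuous_map_diff)

lemma compactin_weak_star_plus:
  assumes "compactin weak_star_topology K" "compactin weak_star_topology L"
  shows "compactin weak_star_topology (K + L)"
proof -
  have "compactin (prod_topology weak_star_topology weak_star_topology) (K \<times> L)"
    using assms by (simp add: compactin_Times)
  from image_compactin[OF this continuous_map_weak_star_add] show ?thesis
    by (simp add: set_plus_image case_prod_unfold)
qed

lemma compactin_weak_star_sum:
  assumes "\<And>i. i \<in> I \<Longrightarrow> compactin weak_star_topology (K i)"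
  shows "compactin weak_star_topology (\<Sum>i\<in>I. K i)"
  using assms
\<comment> \<open>For infinite or empty \<open>I\<close> the sum is the zero of Minkowski addition,
  the compact singleton \<open>{0}\<close>.\<close>
proof (induction I rule: infinite_finite_induct)
  case (insert i I)
  then show ?case
    by (simp add: compactin_weak_star_plus)
qed (simp_all add: strong_operator_topology_topspace)

text \<open>The sum is the projection along the compact factor \<open>K\<close> of the closed set of pairs
  \<open>(s, k)\<close> with \<open>s - k \<in> C\<close>.\<close>

lemma closedin_weak_star_plus_compactin:
  fixes C K :: "('a::real_normed_vector \<Rightarrow>\<^sub>L real) set"
  assumes C: "closedin weak_star_topology C" and K: "compactin weak_star_topology K"
  shows "closedin weak_star_topology (C + K)"
proof -
  let ?W = "weak_star_topology :: ('a \<Rightarrow>\<^sub>L real) topology"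
  let ?P = "prod_topology ?W (subtopology ?W K)"
  have "continuous_map ?P ?W (\<lambda>p. fst p - snd p)"
    unfolding prod_topology_subtopology
    by (intro continuous_map_from_subtopology continuous_map_weak_star_diff)
  then have "closedin ?P {p \<in> topspace ?P. fst p - snd p \<in> C}"
    using C by (rule closedin_continuous_map_preimage)
  \<comment> \<open>This is where compactness of \<open>K\<close> enters.\<close>
  moreover have "closed_map ?P ?W fst"
    using K by (intro Abstract_Topological_Spaces.closed_map_fst) (simp add: compact_space_subtopology)
  ultimately have "closedin ?W (fst ` {p \<in> topspace ?P. fst p - snd p \<in> C})"
    by (simp add: closed_map_def)
  moreover have "fst ` {p \<in> topspace ?P. fst p - snd p \<in> C} = C + K"
  proof -
    have "s \<in> C + K" if "s - k \<in> C" "k \<in> K" for s k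
      using set_plus_intro[OF that] by simp
    moreover have "s \<in> fst ` {p. snd p \<in> K \<and> fst p - snd p \<in> C}" if "s \<in> C + K" for s
    proof -
      obtain c k where "s = c + k" "c \<in> C" "k \<in> K"
        using \<open>s \<in> C + K\<close> by (rule set_plus_elim)
      then show ?thesis
        by (intro image_eqI[of _ _ "(s, k)"]) auto
    qed
    ultimately show ?thesis
      by (force simp: strong_operator_topology_topspace)
  qed
  ultimately show ?thesis
    by simp
qed

section \<open>Weak* compactness of balls\<close>

text \<open>A product of compact intervals is compact, and linearity cuts out a closed subset
  \<open>L\<close> of it. The ball is the image of \<open>L\<close> under \<open>Blinfun\<close>, so
  continuity in this one direction suffices.\<close>

theorem banach_alaoglu:
  fixes R :: real
  shows "compactin weak_star_topology {a :: 'a::real_normed_vector \<Rightarrow>\<^sub>L real. norm a \<le> R}"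
proof (cases "R \<ge> 0")
  case False
  then have "{a :: 'a \<Rightarrow>\<^sub>L real. norm a \<le> R} = {}"
    using norm_ge_zero order_trans by blast
  then show ?thesis
    by (metis compactin_empty)
next
  case True
  define L :: "('a \<Rightarrow> real) set" where "L = {g. linear g \<and> (\<forall>h. \<bar>g h\<bar> \<le> R * norm h)}"
  \<comment> \<open>\<open>Blinfun\<close> inverts \<open>blinfun_apply\<close> only on bounded
    linear functions.\<close>
  have bl: "bounded_linear g" if "g \<in> L" for g
    using that unfolding L_def
    by (auto simp: linear_conv_bounded_linear[symmetric] bounded_linear_def
        bounded_linear_axioms_def intro!: exI[of _ R] simp: mult.commute)
  let ?E = "PiE UNIV (\<lambda>h. {- (R * norm h)..R * norm h}) :: ('a \<Rightarrow> real) set"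
  have "compactin (product_topology (\<lambda>_. euclidean) UNIV) ?E"
    by (simp add: compactin_PiE)
  then have "compact ?E"
    by (simp add: euclidean_product_topology)
  moreover have "closed {g :: 'a \<Rightarrow> real. linear g}"
  proof -
    have "{g :: 'a \<Rightarrow> real. linear g} =
        (\<Inter>h k. {g. g (h + k) = g h + g k}) \<inter> (\<Inter>c h. {g. g (c *\<^sub>R h) = c * g h})"
      by (auto simp: linear_iff)
    then show ?thesis
      by (auto intro!: closed_Int closed_INT closed_Collect_eq continuous_intros)
  qed
  ultimately have "compact (?E \<inter> {g. linear g})"
    by (rule compact_Int_closed)
  also have "?E \<inter> {g. linear g} = L"
    by (auto simp: L_def PiE_iff abs_le_iff) (smt (verit))+
  finally have "compactin (subtopology euclidean L) L"
    by (simp add: compactin_subtopology)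
  moreover have "continuous_map (subtopology euclidean L) weak_star_topology Blinfun"
    unfolding continuous_on_strong_operator_topo_iff_coordinatewise
  proof
    fix h
    have "continuous_map (subtopology euclidean L) euclidean (\<lambda>g. g h)"
      using continuous_on_subset[OF continuous_on_product_coordinates] by auto
    then show "continuous_map (subtopology euclidean L) euclidean (\<lambda>g. blinfun_apply (Blinfun g) h)"
      by (rule continuous_map_eq) (simp add: bl bounded_linear_Blinfun_apply)
  qed
  ultimately have "compactin weak_star_topology (Blinfun ` L)"
    by (rule image_compactin)
  also have "Blinfun ` L = {a :: 'a \<Rightarrow>\<^sub>L real. norm a \<le> R}"
  proof (intro set_eqI iffI)
    fix a
    assume "a \<in> Blinfun ` L"
    then obtain g where g: "g \<in> L" "a = Blinfun g"
      by blast
    have "norm a \<le> R"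
      using g True by (intro norm_blinfun_bound) (auto simp: bounded_linear_Blinfun_apply bl, simp add: L_def)
    then show "a \<in> {a. norm a \<le> R}"
      by simp
  next
    fix a :: "'a \<Rightarrow>\<^sub>L real"
    assume "a \<in> {a. norm a \<le> R}"
    then have "\<bar>blinfun_apply a h\<bar> \<le> R * norm h" for h
      using norm_blinfun[of a h] mult_right_mono[of "norm a" R "norm h"] by simp
    then have "blinfun_apply a \<in> L"
      by (simp add: L_def bounded_linear.linear[OF blinfun.bounded_linear_right])
    then show "a \<in> Blinfun ` L"
      by (metis blinfun_apply_inverse image_eqI)
  qed
  finally show ?thesis .
qed

section \<open>Closedness and bounds for subdifferentials\<close>

text \<open>Each test point \<open>y\<close> imposes one closed condition: a half-space if
  \<open>f y\<close> is real, everything if it is \<infinity>, nothing if it is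
  -\<infinity>.\<close>

lemma closedin_eps_subdifferential:
  "closedin weak_star_topology (eps_subdifferential \<epsilon> f x)"
proof (cases "\<bar>f x\<bar> = \<infinity>")
  case False
  then obtain r where r: "f x = ereal r"
    by auto
  have "closedin weak_star_topology
      {a. ereal (blinfun_apply a (y - x)) + f x \<le> f y + ereal \<epsilon>}" for y
  proof (cases "f y")
    case (real s)
    have "{a. ereal (blinfun_apply a (y - x)) + f x \<le> f y + ereal \<epsilon>} =
        {a. blinfun_apply a (y - x) \<le> s + \<epsilon> - r}"
      by (auto simp: r real)
    then show ?thesis
      by (metis closedin_weak_star_halfspace)
  next
    case PInf
    then show ?thesis
      using closedin_topspace[of weak_star_topology]
      by (simp add: strong_operator_topology_topspace)
  qed (simp add: r)
  then have "closedin weak_star_topology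
      (\<Inter>y. {a. ereal (blinfun_apply a (y - x)) + f x \<le> f y + ereal \<epsilon>})"
    by blast
  also have "\<dots> = eps_subdifferential \<epsilon> f x"
    using False by (auto simp: eps_subdifferential_def)
  finally show ?thesis .
qed (simp add: eps_subdifferential_def)

lemma eps_subdifferential_bound:
  assumes "f y < \<infinity>" "f y \<noteq> - \<infinity>"
  shows "\<exists>N. \<forall>a\<in>eps_subdifferential \<epsilon> f x. blinfun_apply a (y - x) \<le> N"
proof (cases "\<bar>f x\<bar> = \<infinity>")
  case False
  then obtain r s where rs: "f x = ereal r" "f y = ereal s"
    using assms by (cases "f x"; cases "f y") auto
  have "blinfun_apply a (y - x) \<le> s + \<epsilon> - r" if "a \<in> eps_subdifferential \<epsilon> f x" for a
  proof -
    have "ereal (blinfun_apply a (y - x)) + f x \<le> f y + ereal \<epsilon>"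
      using that False by (auto simp: eps_subdifferential_def)
    then show ?thesis
      by (simp add: rs)
  qed
  then show ?thesis
    by blast
qed (simp add: eps_subdifferential_def)

lemma interior_point_add_scaleR:
  fixes z h :: "'a::real_normed_vector"
  assumes "z \<in> interior S"
  shows "\<exists>t>0. z + t *\<^sub>R h \<in> S"
proof -
  obtain e where "e > 0" "cball z e \<subseteq> S"
    using assms by (auto simp: mem_interior_cball)
  \<comment> \<open>The \<open>+ 1\<close> avoids division by zero at \<open>h = 0\<close> and keeps
    the displacement within norm \<open>e\<close>.\<close>
  moreover have "z + (e / (norm h + 1)) *\<^sub>R h \<in> cball z e"
  proof -
    have "e * norm h \<le> e * (norm h + 1)"
      using \<open>e > 0\<close> by simp
    then show ?thesis
      using \<open>e > 0\<close> by (simp add: dist_norm add_nonneg_pos divide_le_eq)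
  qed
  ultimately show ?thesis
    by (intro exI[of _ "e / (norm h + 1)"]) (auto simp: add_nonneg_pos)
qed

text \<open>\<open>R\<close> is chosen before \<open>a\<close>: uniform boundedness is applied to
  the set of \<open>j\<close>-th members of all admissible families at once. Interiority of
  \<open>z\<close> is asked for \<open>j\<close> alone, since only there are bounds needed in all
  directions.\<close>

lemma eps_subgradients_uniformly_bounded:
  fixes f :: "'i \<Rightarrow> 'a::banach \<Rightarrow> ereal"
  assumes "finite I" "j \<in> I"
    and fin: "\<And>i y. i \<in> I \<Longrightarrow> f i y \<noteq> - \<infinity>"
    and z: "\<And>i. i \<in> I \<Longrightarrow> z \<in> edom (f i)" and zj: "z \<in> interior (edom (f j))"
  shows "\<exists>R. \<forall>a. (\<forall>i\<in>I. a i \<in> eps_subdifferential (\<epsilon> i) (f i) x) \<and>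
    c \<le> blinfun_apply (\<Sum>i\<in>I. a i) (z - x) \<longrightarrow> norm (a j) \<le> R"
proof -
  define Q where "Q a \<longleftrightarrow> (\<forall>i\<in>I. a i \<in> eps_subdifferential (\<epsilon> i) (f i) x) \<and>
    c \<le> blinfun_apply (\<Sum>i\<in>I. a i) (z - x)" for a
  have "\<forall>i\<in>I. \<exists>N. \<forall>a\<in>eps_subdifferential (\<epsilon> i) (f i) x. blinfun_apply a (z - x) \<le> N"
    using z fin by (intro ballI eps_subdifferential_bound) (auto simp: edom_def)
  then obtain M where M:
    "\<And>i a. i \<in> I \<Longrightarrow> a \<in> eps_subdifferential (\<epsilon> i) (f i) x \<Longrightarrow> blinfun_apply a (z - x) \<le> M i"
    by metis
  have lower: "c - sum M (I - {j}) \<le> blinfun_apply (a j) (z - x)" if "Q a" for a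
  proof -
    have "c \<le> (\<Sum>i\<in>I. blinfun_apply (a i) (z - x))"
      using that by (simp add: Q_def blinfun.sum_left)
    also have "\<dots> = blinfun_apply (a j) (z - x) + (\<Sum>i\<in>I - {j}. blinfun_apply (a i) (z - x))"
      using assms(1,2) by (simp add: sum.remove)
    also have "(\<Sum>i\<in>I - {j}. blinfun_apply (a i) (z - x)) \<le> sum M (I - {j})"
      using that by (intro sum_mono M) (auto simp: Q_def)
    finally show ?thesis
      by simp
  qed
  have upper: "\<exists>C. \<forall>a. Q a \<longrightarrow> blinfun_apply (a j) h \<le> C" for h
  proof -
    obtain t where t: "t > 0" "z + t *\<^sub>R h \<in> edom (f j)"
      using interior_point_add_scaleR[OF zj] by blast
    then obtain N where N:
      "\<And>a. a \<in> eps_subdifferential (\<epsilon> j) (f j) x \<Longrightarrow> blinfun_apply a (z + t *\<^sub>R h - x) \<le> N"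
      using eps_subdifferential_bound[of "f j" "z + t *\<^sub>R h" "\<epsilon> j" x] fin \<open>j \<in> I\<close>
      by (auto simp: edom_def)
    have "blinfun_apply (a j) h \<le> (N - (c - sum M (I - {j}))) / t" if "Q a" for a
    proof -
      \<comment> \<open>By linearity, the bound \<open>N\<close> splits into a part bounded below by
        \<open>lower\<close> and \<open>t\<close> times the value at \<open>h\<close>.\<close>
      have "blinfun_apply (a j) (z - x) + t * blinfun_apply (a j) h \<le> N"
        using N[of "a j"] that \<open>j \<in> I\<close> by (auto simp: Q_def blinfun.bilinear_simps algebra_simps)
      then show ?thesis
        using lower[OF that] t(1) by (simp add: pos_le_divide_eq mult.commute)
    qed
    then show ?thesis
      by blast
  qed
  have "\<exists>C. \<forall>b\<in>{a j | a. Q a}. norm (blinfun_apply b h) \<le> C" for h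
  proof -
    obtain C C' where "\<And>a. Q a \<Longrightarrow> blinfun_apply (a j) h \<le> C"
      "\<And>a. Q a \<Longrightarrow> blinfun_apply (a j) (- h) \<le> C'"
      using upper by metis
    then show ?thesis
      by (intro exI[of _ "max C C'"]) (force simp: blinfun.bilinear_simps abs_le_iff le_max_iff_disj)
  qed
  then have "\<exists>R. \<forall>b\<in>{a j | a. Q a}. norm b \<le> R"
    by (rule uniform_bounded_blinfun)
  then show ?thesis
    unfolding Q_def by blast
qed

section \<open>Closedness of the sum\<close>

theorem lemma4p2:
  fixes f :: "nat \<Rightarrow> 'a::banach \<Rightarrow> ereal"
    and \<epsilon> :: "nat \<Rightarrow> real"
    and m :: nat
  assumes "m \<ge> 1"
    and "\<And>i. i \<in> {1..m} \<Longrightarrow> \<epsilon> i \<ge> 0"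
    and "\<And>i x. i \<in> {1..m} \<Longrightarrow> f i x \<noteq> -\<infinity>"
    and "\<And>i. i \<in> {1..m} \<Longrightarrow> proper_fun (f i)"
    and "\<And>i. i \<in> {1..m} \<Longrightarrow> lower_semicontinuous (f i)"
    and "\<And>i. i \<in> {1..m} \<Longrightarrow> econvex (f i)"
    and "edom (f 1) \<inter> (\<Inter>i\<in>{2..m}. interior (edom (f i))) \<noteq> {}"
  shows "\<forall>x \<in> (\<Inter>i\<in>{1..m}. edom (f i)).
    closedin weak_star_topology (\<Sum>i=1..m. eps_subdifferential (\<epsilon> i) (f i) x)"
proof
  fix x
  let ?W = "weak_star_topology :: ('a \<Rightarrow>\<^sub>L real) topology"
  define A where "A i = eps_subdifferential (\<epsilon> i) (f i) x" for i
  define S where "S = (\<Sum>i=1..m. A i)"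
  have S_iff: "s \<in> S \<longleftrightarrow> (\<exists>a. s = (\<Sum>i=1..m. a i) \<and> (\<forall>i\<in>{1..m}. a i \<in> A i))" for s
    by (auto simp: S_def set_sum_alt)
  \<comment> \<open>Index 1 is set apart because \<open>z\<close> need not be interior to
    \<open>edom (f 1)\<close>: \<open>A 1\<close> becomes the closed summand, the others yield
    compact ones.\<close>
  have split: "sum g {1..m} = g 1 + sum g {2..m}" for g :: "nat \<Rightarrow> 'c::comm_monoid_add"
    using sum.atLeast_Suc_atMost[OF \<open>m \<ge> 1\<close>, of g] by (simp add: numeral_2_eq_2)
  obtain z where z1: "z \<in> edom (f 1)" and z2: "\<And>i. i \<in> {2..m} \<Longrightarrow> z \<in> interior (edom (f i))"
    using assms(7) by blast
  have z: "z \<in> edom (f i)" if "i \<in> {1..m}" for i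
    using z1 z2[of i] interior_subset that by (cases "i = 1") auto
  have "u \<in> S" if u: "u \<in> ?W closure_of S" for u
  proof -
    \<comment> \<open>Subtracting 1 puts \<open>u\<close> inside the open half-space
      \<open>V\<close>.\<close>
    define c where "c = blinfun_apply u (z - x) - 1"
    define V where "V = {s :: 'a \<Rightarrow>\<^sub>L real. c < blinfun_apply s (z - x)}"
    have "\<forall>j\<in>{2..m}. \<exists>R. \<forall>a. (\<forall>i\<in>{1..m}. a i \<in> A i) \<and>
        c \<le> blinfun_apply (\<Sum>i=1..m. a i) (z - x) \<longrightarrow> norm (a j) \<le> R"
      unfolding A_def using assms(3) z z2
      by (intro ballI eps_subgradients_uniformly_bounded) auto
    then obtain R where R: "\<And>j a. j \<in> {2..m} \<Longrightarrow> \<forall>i\<in>{1..m}. a i \<in> A i \<Longrightarrow>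
        c \<le> blinfun_apply (\<Sum>i=1..m. a i) (z - x) \<Longrightarrow> norm (a j) \<le> R j"
      by metis
    define B where "B j = A j \<inter> {a. norm a \<le> R j}" for j
    define D where "D = A 1 + (\<Sum>j=2..m. B j)"
    have closed_A: "closedin ?W (A j)" for j
      unfolding A_def by (rule closedin_eps_subdifferential)
    have "compactin ?W (B j)" for j
      unfolding B_def by (rule closed_Int_compactin[OF closed_A banach_alaoglu])
    then have closed_D: "closedin ?W D"
      unfolding D_def by (intro closedin_weak_star_plus_compactin closed_A compactin_weak_star_sum)
    have "V \<inter> S \<subseteq> D"
    proof
      fix s
      assume "s \<in> V \<inter> S"
      then obtain a where a: "s = (\<Sum>i=1..m. a i)" "\<forall>i\<in>{1..m}. a i \<in> A i"
        "c \<le> blinfun_apply (\<Sum>i=1..m. a i) (z - x)"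
        by (force simp: S_iff V_def)
      have "a j \<in> B j" if "j \<in> {2..m}" for j
        using R[OF that a(2,3)] a(2) that by (auto simp: B_def)
      then have "(\<Sum>j=2..m. a j) \<in> (\<Sum>j=2..m. B j)"
        by (auto simp: set_sum_alt)
      moreover have "a 1 \<in> A 1"
        using a(2) \<open>m \<ge> 1\<close> by auto
      ultimately show "s \<in> D"
        unfolding a(1) split D_def by (intro set_plus_intro)
    qed
    moreover have "openin ?W V"
      using closedin_weak_star_halfspace[of "z - x" c]
      by (simp add: closedin_def V_def strong_operator_topology_topspace Compl_eq[symmetric]
          Collect_neg_eq[symmetric] not_le Compl_eq_Diff_UNIV[symmetric])
    moreover have "u \<in> V"
      by (simp add: V_def c_def)
    \<comment> \<open>As \<open>V\<close> is an open neighbourhood of \<open>u\<close>, a closure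
      point of \<open>S\<close>, \<open>u\<close> is also a closure point of
      \<open>V \<inter> S\<close>, hence of \<open>D\<close>.\<close>
    ultimately have "u \<in> ?W closure_of D"
      using u openin_Int_closure_of_subset[of ?W V S] closure_of_mono[of "V \<inter> S" D ?W] by blast
    then have "u \<in> D"
      using closed_D by (simp add: closure_of_closedin)
    moreover have "D \<subseteq> S"
      unfolding D_def S_def split
      by (intro set_plus_mono2 order_refl) (auto simp: set_sum_alt B_def)
    ultimately show "u \<in> S"
      by blast
  qed
  then have "?W closure_of S \<subseteq> S"
    by blast
  then have "closedin ?W S"
    by (simp add: closure_of_subset_eq[symmetric] strong_operator_topology_topspace)
  then show "closedin ?W (\<Sum>i=1..m. eps_subdifferential (\<epsilon> i) (f i) x)"
    by (simp add: S_def A_def)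
qed

end
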